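(* Let $X$ be a locally convex Hausdorff real topological vector space, let $(f_i)_{i\in I}$ be a family of proper functions $f_i:X\to\mathbb R\cup\{+\infty\}$ with robust sum $f$, and let $\overline{x}^*\in X^*$. Let $x\in\operatorname{dom}f$ and assume that $\inf(\mathrm{RP}_{\overline{x}^*})=\max(\mathrm{RD}_{\overline{x}^*})$. The following statements are equivalent: (i) $x\in\operatorname{sol}(\mathrm{RP}_{\overline{x}^*})$. (ii) For all $(J,(x_j^* )_{j\in J})\in\operatorname{sol}(\mathrm{RD}_{\overline{x}^*})$ one has $J\in S_f(x)$ and $x_j^*\in\partial f_j(x)$ for all $j\in J$. (iii) There exists $(J,(x_j^* )_{j\in J})\in\operatorname{sol}(\mathrm{RD}_{\overline{x}^*})$ such that $J\in S_f(x)$ and $x_j^*\in\partial f_j(x)$ for all $j\in J$. (iv) There exists $(J,(x_j^* )_{j\in J})\in\mathbb F(\overline{x}^* )$ such that $J\in S_f(x)$ and $x_j^*\in\partial f_j(x)$ for all $j\in J$. Moreover, for any $(J,(x_j^* )_{j\in J})\in\operatorname{sol}(\mathrm{RD}_{\overline{x}^*})$ one has $$\operatorname{sol}(\mathrm{RP}_{\overline{x}^*})=T_f(J)\cap\Big(\bigcap_{j\in J}M_{f_j}(x_j^* )\Big).$$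
   Context: $X^*$ is the topological dual of $X$ and $\langle x^*,x\rangle$ the duality pairing. $I$ is an infinite index set and $\mathcal F(I)$ is the collection of all nonempty finite subsets of $I$. The robust sum is $f(x)=\sum_{i\in I}^R f_i(x):=\sup_{J\in\mathcal F(I)}\sum_{i\in J}f_i(x)$. For $h:X\to\overline{\mathbb R}$, $\operatorname{dom}h=\{x:h(x)<+\infty\}$, $h^*(x^* )=\sup_{x\in X}\{\langle x^*,x\rangle-h(x)\}$, and $\partial h(a)=\{x^*\in X^*: h(x)\ge h(a)+\langle x^*,x-a\rangle\ \forall x\in X\}$ if $h(a)\in\mathbb R$, $\partial h(a)=\emptyset$ otherwise. Feasible dual set: $\mathbb F(\overline{x}^* )=\{(J,(x_j^* )_{j\in J}): J\in\mathcal F(I),\ (x_j^* )_{j\in J}\in(X^* )^J,\ \sum_{j\in J}x_j^*=\overline{x}^*\}$. Primal problem $(\mathrm{RP}_{\overline{x}^*})$: $\inf\{f(x)-\langle\overline{x}^*,x\rangle:x\in X\}$. Dual problem $(\mathrm{RD}_{\overline{x}^*})$: $\sup\{-\sum_{j\in J}f_j^*(x_j^* ):(J,(x_j^* )_{j\in J})\in\mathbb F(\overline{x}^* )\}$. $\operatorname{sol}(\mathrm{RP}_{\overline{x}^*})=\{x\in X: f(x)-\langle\overline{x}^*,x\rangle=\inf(\mathrm{RP}_{\overline{x}^*})\}$ and $\operatorname{sol}(\mathrm{RD}_{\overline{x}^*})=\{(J,(x_j^* )_{j\in J})\in\mathbb F(\overline{x}^* ): -\sum_{j\in J}f_j^*(x_j^*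 )=\sup(\mathrm{RD}_{\overline{x}^*})\}$. Writing $\max(\mathrm{RD}_{\overline{x}^*})$ instead of $\sup(\mathrm{RD}_{\overline{x}^*})$ means that $\operatorname{sol}(\mathrm{RD}_{\overline{x}^*})\neq\emptyset$; so $\inf(\mathrm{RP}_{\overline{x}^*})=\max(\mathrm{RD}_{\overline{x}^*})$ means that the two optimal values (in $\overline{\mathbb R}$) coincide and $\operatorname{sol}(\mathrm{RD}_{\overline{x}^*})\ne\emptyset$. For $x\in X$: $S_f(x)=\{J\in\mathcal F(I):\sum_{j\in J}f_j(x)=f(x)\}$ if $x\in\operatorname{dom}f$, and $S_f(x)=\emptyset$ otherwise. $T_f:\mathcal F(I)\rightrightarrows X$ is the inverse of $S_f$: $x\in T_f(J)\iff J\in S_f(x)$. For $g:X\to\overline{\mathbb R}$, $M_g:X^*\rightrightarrows X$ is given by $M_g(x^* )=\operatorname{argmin}(g-\langle x^*,\cdot\rangle)$ if $g^*(x^* )\in\mathbb R$ and $M_g(x^* )=\emptyset$ otherwise; equivalently, $x\in M_g(x^* )\iff x^*\in\partial g(x)$. *)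

theory Defs
  imports "HOL-Analysis.Analysis"
begin

class locally_convex_t2_space = real_vector + topological_ab_group_add + t2_space +
  assumes tendsto_scaleR_Pair:
      "filterlim (\<lambda>p. fst p *\<^sub>R snd p) (nhds (c *\<^sub>R x)) (nhds (c::real) \<times>\<^sub>F nhds x)"
    and locally_convex_0_expanded:
      "open U \<Longrightarrow> 0 \<in> U \<Longrightarrow> \<exists>V. open V \<and> 0 \<in> V \<and> V \<subseteq> U \<and>
        (\<forall>y\<in>V. \<forall>z\<in>V. \<forall>a\<ge>0. \<forall>b\<ge>0. a + b = 1 \<longrightarrow> a *\<^sub>R y + b *\<^sub>R z \<in> V)"

text \<open>
  The class specification cannot mention \<open>convex\<close> (its sort constraint is rejected there), hence
  the expanded axiom.
\<close>

lemma locally_convex_0: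
  fixes U :: "'a::locally_convex_t2_space set"
  shows "open U \<Longrightarrow> 0 \<in> U \<Longrightarrow> \<exists>V. open V \<and> 0 \<in> V \<and> V \<subseteq> U \<and> convex V"
  unfolding convex_def by (rule locally_convex_0_expanded)

instance real_normed_vector \<subseteq> locally_convex_t2_space
proof
  fix c :: real and x :: 'a
  have "(fst \<longlongrightarrow> c) (nhds c \<times>\<^sub>F nhds x)" "(snd \<longlongrightarrow> x) (nhds c \<times>\<^sub>F nhds x)"
    by (simp_all add: filterlim_fst filterlim_snd)
  then show "filterlim (\<lambda>p. fst p *\<^sub>R snd p) (nhds (c *\<^sub>R x)) (nhds c \<times>\<^sub>F nhds x)"
    by (rule tendsto_scaleR)
next
  fix U :: "'a set"
  assume "open U" "0 \<in> U"
  then obtain e where "e > 0" "ball 0 e \<subseteq> U"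
    by (auto simp: open_contains_ball)
  then show "\<exists>V. open V \<and> 0 \<in> V \<and> V \<subseteq> U \<and>
      (\<forall>y\<in>V. \<forall>z\<in>V. \<forall>a\<ge>0. \<forall>b\<ge>0. a + b = 1 \<longrightarrow> a *\<^sub>R y + b *\<^sub>R z \<in> V)"
    using convex_ball[of "0::'a" e] unfolding convex_def
    by (intro exI[of _ "ball 0 e"]) simp
qed

text \<open>The pairing of \<open>u \<in> top_dual\<close> with \<open>x\<close> is the application \<open>u x\<close>.\<close>

definition top_dual :: "('a::locally_convex_t2_space \<Rightarrow> real) set" where
  "top_dual = {u. linear u \<and> continuous_on UNIV u}"

definition edom :: "('a \<Rightarrow> ereal) \<Rightarrow> 'a set" where
  "edom h = {x. h x < \<infinity>}"

definition proper_fun :: "('a \<Rightarrow> ereal) \<Rightarrow> bool" where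
  "proper_fun h \<longleftrightarrow> (\<forall>x. h x \<noteq> -\<infinity>) \<and> edom h \<noteq> {}"

definition conjugate :: "('a \<Rightarrow> ereal) \<Rightarrow> ('a \<Rightarrow> real) \<Rightarrow> ereal" where
  "conjugate h u = (SUP x. ereal (u x) - h x)"

definition subdiff :: "('a::locally_convex_t2_space \<Rightarrow> ereal) \<Rightarrow> 'a \<Rightarrow> ('a \<Rightarrow> real) set" where
  "subdiff h a =
    (if \<bar>h a\<bar> \<noteq> \<infinity> then {u \<in> top_dual. \<forall>x. h x \<ge> h a + ereal (u (x - a))} else {})"

definition argmin_map :: "('a \<Rightarrow> ereal) \<Rightarrow> ('a \<Rightarrow> real) \<Rightarrow> 'a set" where
  "argmin_map g u =
    (if \<bar>conjugate g u\<bar> \<noteq> \<infinity>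
     then {x. is_arg_min (\<lambda>z. g z - ereal (u z)) (\<lambda>_. True) x} else {})"

definition fin_subsets :: "'i set \<Rightarrow> 'i set set" where
  "fin_subsets I = {J. J \<subseteq> I \<and> finite J \<and> J \<noteq> {}}"

definition robust_sum :: "'i set \<Rightarrow> ('i \<Rightarrow> 'a \<Rightarrow> ereal) \<Rightarrow> 'a \<Rightarrow> ereal" where
  "robust_sum I f x = (SUP J\<in>fin_subsets I. \<Sum>j\<in>J. f j x)"

text \<open>
  A family indexed by \<open>J\<close> is an extensional function on \<open>J\<close> (undefined outside \<open>J\<close>),
  so that distinct representatives are distinct families.
\<close>

definition dual_feasible ::
    "'i set \<Rightarrow> ('a::locally_convex_t2_space \<Rightarrow> real) \<Rightarrow> ('i set \<times> ('i \<Rightarrow> 'a \<Rightarrow> real)) set" where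
  "dual_feasible I xbar =
    {(J, u). J \<in> fin_subsets I \<and> u \<in> (\<Pi>\<^sub>E j\<in>J. top_dual) \<and> (\<forall>x. (\<Sum>j\<in>J. u j x) = xbar x)}"

definition RP_obj :: "'i set \<Rightarrow> ('i \<Rightarrow> 'a \<Rightarrow> ereal) \<Rightarrow> ('a \<Rightarrow> real) \<Rightarrow> 'a \<Rightarrow> ereal" where
  "RP_obj I f xbar x = robust_sum I f x - ereal (xbar x)"

definition RP_inf :: "'i set \<Rightarrow> ('i \<Rightarrow> 'a \<Rightarrow> ereal) \<Rightarrow> ('a \<Rightarrow> real) \<Rightarrow> ereal" where
  "RP_inf I f xbar = (INF x. RP_obj I f xbar x)"

definition RP_sol :: "'i set \<Rightarrow> ('i \<Rightarrow> 'a \<Rightarrow> ereal) \<Rightarrow> ('a \<Rightarrow> real) \<Rightarrow> 'a set" where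
  "RP_sol I f xbar = {x. RP_obj I f xbar x = RP_inf I f xbar}"

definition RD_obj :: "('i \<Rightarrow> 'a \<Rightarrow> ereal) \<Rightarrow> 'i set \<Rightarrow> ('i \<Rightarrow> 'a \<Rightarrow> real) \<Rightarrow> ereal" where
  "RD_obj f J u = - (\<Sum>j\<in>J. conjugate (f j) (u j))"

definition RD_sup ::
    "'i set \<Rightarrow> ('i \<Rightarrow> 'a::locally_convex_t2_space \<Rightarrow> ereal) \<Rightarrow> ('a \<Rightarrow> real) \<Rightarrow> ereal" where
  "RD_sup I f xbar = (SUP (J, u)\<in>dual_feasible I xbar. RD_obj f J u)"

definition RD_sol ::
    "'i set \<Rightarrow> ('i \<Rightarrow> 'a::locally_convex_t2_space \<Rightarrow> ereal) \<Rightarrow> ('a \<Rightarrow> real)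
      \<Rightarrow> ('i set \<times> ('i \<Rightarrow> 'a \<Rightarrow> real)) set" where
  "RD_sol I f xbar = {(J, u) \<in> dual_feasible I xbar. RD_obj f J u = RD_sup I f xbar}"

definition S_map :: "'i set \<Rightarrow> ('i \<Rightarrow> 'a \<Rightarrow> ereal) \<Rightarrow> 'a \<Rightarrow> 'i set set" where
  "S_map I f x =
    (if x \<in> edom (robust_sum I f)
     then {J \<in> fin_subsets I. (\<Sum>j\<in>J. f j x) = robust_sum I f x} else {})"

definition T_map :: "'i set \<Rightarrow> ('i \<Rightarrow> 'a \<Rightarrow> ereal) \<Rightarrow> 'i set \<Rightarrow> 'a set" where
  "T_map I f J = {x. J \<in> S_map I f x}"

end

theory Submission
  imports Defs
begin

text \<open>
  For a feasible pair \<open>(J, u)\<close> and a point \<open>x\<close> where the robust sum is finite, the duality gap is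
  the sum of the nonnegative terms \<open>robust_sum I f x - (\<Sum>j\<in>J. f j x)\<close> and
  \<open>f j x + conjugate (f j) (u j) - u j x\<close> for \<open>j \<in> J\<close>. Hence the gap vanishes iff
  \<open>J \<in> S_map I f x\<close> and Fenchel's inequality is an equality for each \<open>j\<close>, that is,
  \<open>u j \<in> subdiff (f j) x\<close>. All the equivalences follow, because under strong duality a primal
  point and a dual solution have zero gap exactly when the point is optimal.
\<close>

lemma Fenchel_Young: "ereal (u x) - h x \<le> conjugate h u"
  unfolding conjugate_def by (rule SUP_upper) simp

text \<open>By linearity of \<open>u\<close>, the subgradient inequality at \<open>z\<close>
  rearranges to \<open>ereal (u z) - h z \<le> ereal (u x - a)\<close>; the supremum over
  \<open>z\<close> is the conjugate. With \<open>Fenchel_Young\<close> this is equality in Fenchel's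
  inequality.\<close>

lemma subdiff_iff_conjugate_le:
  assumes "u \<in> top_dual" "h x = ereal a"
  shows "u \<in> subdiff h x \<longleftrightarrow> conjugate h u \<le> ereal (u x - a)"
proof -
  have lin: "u (z - x) = u z - u x" for z
    using assms(1) by (simp add: top_dual_def linear_diff)
  have "h x + ereal (u (z - x)) \<le> h z \<longleftrightarrow> ereal (u z) - h z \<le> ereal (u x - a)" for z
    by (cases "h z") (auto simp: assms(2) lin)
  then show ?thesis
    using assms by (simp add: subdiff_def conjugate_def SUP_le_iff)
qed

text \<open>The guard in \<open>argmin_map\<close> is automatic here: a real value
  \<open>h x\<close> keeps the conjugate above \<open>-\<infinity>\<close>, and a subgradient at
  \<open>x\<close> bounds it from above.\<close>

lemma argmin_map_iff_subdiff:
  assumes "u \<in> top_dual" "h x = ereal a"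
  shows "x \<in> argmin_map h u \<longleftrightarrow> u \<in> subdiff h x"
proof -
  have gt: "conjugate h u \<noteq> -\<infinity>"
    using Fenchel_Young[of u x h] assms(2) by auto
  have min: "is_arg_min (\<lambda>z. h z - ereal (u z)) (\<lambda>_. True) x \<longleftrightarrow> u \<in> subdiff h x"
  proof -
    have "\<not> h z - ereal (u z) < h x - ereal (u x) \<longleftrightarrow> ereal (u z) - h z \<le> ereal (u x - a)" for z
      by (cases "h z") (auto simp: assms(2))
    then show ?thesis
      unfolding subdiff_iff_conjugate_le[of u h x a, OF assms]
      by (simp add: is_arg_min_def conjugate_def SUP_le_iff)
  qed
  have "conjugate h u \<noteq> \<infinity>" if "u \<in> subdiff h x"
    using that subdiff_iff_conjugate_le[of u h x a, OF assms] by auto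
  with gt min show ?thesis
    by (auto simp: argmin_map_def)
qed

lemma sum_le_robust_sum:
  "J \<in> fin_subsets I \<Longrightarrow> (\<Sum>j\<in>J. f j x) \<le> robust_sum I f x"
  unfolding robust_sum_def by (rule SUP_upper)

text \<open>Singletons are admissible index sets, so each \<open>f j x\<close> lies below the robust
  sum.\<close>

lemma proper_summand_real:
  assumes "\<forall>i\<in>I. proper_fun (f i)" "x \<in> edom (robust_sum I f)" "j \<in> I"
  obtains a where "f j x = ereal a"
proof -
  have "f j x \<le> robust_sum I f x"
    using sum_le_robust_sum[of "{j}" I f x] \<open>j \<in> I\<close> by (simp add: fin_subsets_def)
  then have "f j x \<noteq> \<infinity>"
    using assms(2) by (auto simp: edom_def)
  moreover have "f j x \<noteq> -\<infinity>"
    using assms(1) \<open>j \<in> I\<close> by (simp add: proper_fun_def)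
  ultimately show thesis
    using that by (cases "f j x") auto
qed

text \<open>Only feasibility of \<open>(J, u)\<close> is assumed, so the criterion applies both to
  dual solutions and to the merely feasible pairs of (iv).\<close>

lemma RP_obj_le_RD_obj_iff:
  fixes f :: "'i \<Rightarrow> 'a::locally_convex_t2_space \<Rightarrow> ereal"
  assumes proper: "\<forall>i\<in>I. proper_fun (f i)"
    and x: "x \<in> edom (robust_sum I f)"
    and feas: "(J, u) \<in> dual_feasible I xbar"
  shows "RP_obj I f xbar x \<le> RD_obj f J u \<longleftrightarrow>
    J \<in> S_map I f x \<and> (\<forall>j\<in>J. u j \<in> subdiff (f j) x)"
proof -
  have J: "J \<in> fin_subsets I" "J \<subseteq> I" "finite J" "J \<noteq> {}"
    and u: "\<And>j. j \<in> J \<Longrightarrow> u j \<in> top_dual" and xbar: "(\<Sum>j\<in>J. u j x) = xbar x"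
    using feas by (auto simp: dual_feasible_def fin_subsets_def)
  have "\<exists>a. f j x = ereal a" if "j \<in> J" for j
    using proper_summand_real[OF proper x] J(2) that by (metis subsetD)
  then obtain a where a: "\<And>j. j \<in> J \<Longrightarrow> f j x = ereal (a j)"
    by metis
  have sum_a: "(\<Sum>j\<in>J. f j x) = ereal (\<Sum>j\<in>J. a j)"
    by (simp add: a)
  have le: "ereal (\<Sum>j\<in>J. a j) \<le> robust_sum I f x"
    using sum_le_robust_sum[OF J(1), of f x] sum_a by simp
  then obtain r where r: "robust_sum I f x = ereal r"
    using x by (cases "robust_sum I f x") (auto simp: edom_def)
  have S: "J \<in> S_map I f x \<longleftrightarrow> (\<Sum>j\<in>J. a j) = r"
    using J(1) x by (simp add: S_map_def sum_a r)
  have conj_ge: "ereal (u j x - a j) \<le> conjugate (f j) (u j)" if "j \<in> J" for j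
    using Fenchel_Young[of "u j" x "f j"] a[OF that] by simp
  have sub: "u j \<in> subdiff (f j) x \<longleftrightarrow> conjugate (f j) (u j) \<le> ereal (u j x - a j)"
    if "j \<in> J" for j
    using subdiff_iff_conjugate_le[of "u j" "f j" x "a j", OF u[OF that] a[OF that]] .
  show ?thesis
  proof
    assume gap: "RP_obj I f xbar x \<le> RD_obj f J u"
    have "(\<Sum>j\<in>J. conjugate (f j) (u j)) \<noteq> \<infinity>"
      using gap by (auto simp: RP_obj_def RD_obj_def r)
    \<comment> \<open>In \<open>ereal\<close> a finite sum is \<open>\<infinity>\<close> as soon as
      one summand is. Together with \<open>conj_ge\<close> this makes every conjugate real, so the
      rest is real arithmetic.\<close>
    then have fin: "conjugate (f j) (u j) \<noteq> \<infinity>" if "j \<in> J" for j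
      using that J(3) by (auto simp: sum_Pinfty)
    have "\<exists>c. conjugate (f j) (u j) = ereal c" if "j \<in> J" for j
      using conj_ge[OF that] fin[OF that] by (cases "conjugate (f j) (u j)") auto
    then obtain c where c: "\<And>j. j \<in> J \<Longrightarrow> conjugate (f j) (u j) = ereal (c j)"
      by metis
    have nonneg: "0 \<le> a j + c j - u j x" if "j \<in> J" for j
      using conj_ge[OF that] c[OF that] by simp
    have "r - xbar x \<le> - (\<Sum>j\<in>J. c j)"
      using gap by (simp add: RP_obj_def RD_obj_def r c)
    moreover have split: "(\<Sum>j\<in>J. a j + c j - u j x) = (\<Sum>j\<in>J. a j) + (\<Sum>j\<in>J. c j) - xbar x"
      by (simp add: sum.distrib sum_subtractf xbar)
    moreover have "(\<Sum>j\<in>J. a j) \<le> r"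
      using le r by simp
    moreover have "0 \<le> (\<Sum>j\<in>J. a j + c j - u j x)"
      using nonneg by (rule sum_nonneg)
    \<comment> \<open>The gap is \<open>r - (\<Sum>j\<in>J. a j)\<close> plus the sum in
      \<open>split\<close>: two nonnegative numbers with total at most 0.\<close>
    ultimately have "(\<Sum>j\<in>J. a j) = r" and zero: "(\<Sum>j\<in>J. a j + c j - u j x) = 0"
      by linarith+
    moreover have "a j + c j - u j x = 0" if "j \<in> J" for j
      using sum_nonneg_0[OF J(3) nonneg zero that] by simp
    then have "\<forall>j\<in>J. u j \<in> subdiff (f j) x"
      using sub c by force
    ultimately show "J \<in> S_map I f x \<and> (\<forall>j\<in>J. u j \<in> subdiff (f j) x)"
      using S by simp
  next
    assume opt: "J \<in> S_map I f x \<and> (\<forall>j\<in>J. u j \<in> subdiff (f j) x)"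
    have "(\<Sum>j\<in>J. conjugate (f j) (u j)) = (\<Sum>j\<in>J. ereal (u j x - a j))"
      using opt sub conj_ge by (intro sum.cong refl antisym) auto
    then have "RD_obj f J u = ereal (r - xbar x)"
      using opt S by (simp add: RD_obj_def sum_subtractf xbar)
    then show "RP_obj I f xbar x \<le> RD_obj f J u"
      by (simp add: RP_obj_def r)
  qed
qed

text \<open>A point of the domain makes the primal infimum less than \<open>\<infinity>\<close>. If
  the domain were empty, every point would count as a solution.\<close>

lemma RP_sol_subset_edom:
  assumes "x \<in> edom (robust_sum I f)"
  shows "RP_sol I f xbar \<subseteq> edom (robust_sum I f)"
proof
  fix y assume "y \<in> RP_sol I f xbar"
  then have "RP_obj I f xbar y \<le> RP_obj I f xbar x"
    unfolding RP_sol_def RP_inf_def by (auto intro: INF_lower)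
  then show "y \<in> edom (robust_sum I f)"
    using assms
    by (cases "robust_sum I f x"; cases "robust_sum I f y") (auto simp: RP_obj_def edom_def)
qed

text \<open>Strong duality turns the dual value of \<open>(J, u)\<close> into the primal infimum, so
  optimality of \<open>x\<close> is exactly the inequality of
  \<open>RP_obj_le_RD_obj_iff\<close>.\<close>

lemma RP_sol_iff_RD_sol:
  fixes f :: "'i \<Rightarrow> 'a::locally_convex_t2_space \<Rightarrow> ereal"
  assumes proper: "\<forall>i\<in>I. proper_fun (f i)"
    and x: "x \<in> edom (robust_sum I f)"
    and strong: "RP_inf I f xbar = RD_sup I f xbar"
    and sol: "(J, u) \<in> RD_sol I f xbar"
  shows "x \<in> RP_sol I f xbar \<longleftrightarrow> J \<in> S_map I f x \<and> (\<forall>j\<in>J. u j \<in> subdiff (f j) x)"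
proof -
  have feas: "(J, u) \<in> dual_feasible I xbar" and opt: "RD_obj f J u = RP_inf I f xbar"
    using sol strong by (auto simp: RD_sol_def)
  have "RP_inf I f xbar \<le> RP_obj I f xbar x"
    unfolding RP_inf_def by (rule INF_lower) simp
  then have "x \<in> RP_sol I f xbar \<longleftrightarrow> RP_obj I f xbar x \<le> RD_obj f J u"
    unfolding opt RP_sol_def by auto
  with RP_obj_le_RD_obj_iff[OF proper x feas] show ?thesis
    by simp
qed

theorem corollary4p1:
  fixes I :: "'i set"
    and f :: "'i \<Rightarrow> 'a::locally_convex_t2_space \<Rightarrow> ereal"
    and xbar :: "'a \<Rightarrow> real"
    and x :: 'a
  assumes "infinite I"
    and "\<And>i. i \<in> I \<Longrightarrow> proper_fun (f i)"
    and "xbar \<in> top_dual"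
    and "x \<in> edom (robust_sum I f)"
    and "RP_inf I f xbar = RD_sup I f xbar"
    and "RD_sol I f xbar \<noteq> {}"
  shows "(x \<in> RP_sol I f xbar \<longleftrightarrow>
           (\<forall>(J, u)\<in>RD_sol I f xbar. J \<in> S_map I f x \<and> (\<forall>j\<in>J. u j \<in> subdiff (f j) x)))
       \<and> (x \<in> RP_sol I f xbar \<longleftrightarrow>
           (\<exists>(J, u)\<in>RD_sol I f xbar. J \<in> S_map I f x \<and> (\<forall>j\<in>J. u j \<in> subdiff (f j) x)))
       \<and> (x \<in> RP_sol I f xbar \<longleftrightarrow>
           (\<exists>(J, u)\<in>dual_feasible I xbar. J \<in> S_map I f x \<and> (\<forall>j\<in>J. u j \<in> subdiff (f j) x)))
       \<and> (\<forall>(J, u)\<in>RD_sol I f xbar.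
           RP_sol I f xbar = T_map I f J \<inter> (\<Inter>j\<in>J. argmin_map (f j) (u j)))"
proof -
  have proper: "\<forall>i\<in>I. proper_fun (f i)"
    using assms(2) by blast
  note strong = assms(5)
  note sol_iff = RP_sol_iff_RD_sol[OF proper assms(4) strong]
  have feas: "(J, u) \<in> dual_feasible I xbar" if "(J, u) \<in> RD_sol I f xbar" for J u
    using that by (simp add: RD_sol_def)
  have iv_i: "x \<in> RP_sol I f xbar"
    if "(J, u) \<in> dual_feasible I xbar" "J \<in> S_map I f x \<and> (\<forall>j\<in>J. u j \<in> subdiff (f j) x)" for J u
  proof -
    have "RP_obj I f xbar x \<le> RD_obj f J u"
      using RP_obj_le_RD_obj_iff[OF proper assms(4) that(1)] that(2) by simp
    also have "\<dots> \<le> RD_sup I f xbar"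
      unfolding RD_sup_def using that(1) by (intro SUP_upper2[of "(J, u)"]) auto
    finally have "RP_obj I f xbar x \<le> RP_inf I f xbar"
      using strong by simp
    moreover have "RP_inf I f xbar \<le> RP_obj I f xbar x"
      unfolding RP_inf_def by (rule INF_lower) simp
    ultimately show ?thesis
      by (simp add: RP_sol_def)
  qed
  \<comment> \<open>Dual attainment keeps the universal statement (ii) from being vacuous and
    supplies the witness for (iii) and (iv).\<close>
  obtain J0 u0 where ex: "(J0, u0) \<in> RD_sol I f xbar"
    using assms(6) by auto
  have sol_eq: "RP_sol I f xbar = T_map I f J \<inter> (\<Inter>j\<in>J. argmin_map (f j) (u j))"
    if sol: "(J, u) \<in> RD_sol I f xbar" for J u
  proof (rule set_eqI)
    fix y
    have J: "J \<subseteq> I" and u: "\<And>j. j \<in> J \<Longrightarrow> u j \<in> top_dual"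
      using feas[OF sol] by (auto simp: dual_feasible_def fin_subsets_def)
    show "y \<in> RP_sol I f xbar \<longleftrightarrow> y \<in> T_map I f J \<inter> (\<Inter>j\<in>J. argmin_map (f j) (u j))"
    \<comment> \<open>Inside the domain all \<open>f j y\<close> with \<open>j \<in> J\<close> are
      real, so \<open>argmin_map\<close> and \<open>subdiff\<close> correspond. Outside it
      \<open>S_map\<close> is empty and no primal solution exists, so neither side contains
      \<open>y\<close>.\<close>
    proof (cases "y \<in> edom (robust_sum I f)")
      case True
      have "y \<in> argmin_map (f j) (u j) \<longleftrightarrow> u j \<in> subdiff (f j) y" if "j \<in> J" for j
      proof -
        have "j \<in> I"
          using J that by blast
        then obtain a where "f j y = ereal a"
          by (rule proper_summand_real[OF proper True])
        then show ?thesis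
          using argmin_map_iff_subdiff u[OF that] by blast
      qed
      then show ?thesis
        using RP_sol_iff_RD_sol[OF proper True strong sol] by (auto simp: T_map_def)
    next
      case False
      then show ?thesis
        using RP_sol_subset_edom[OF assms(4)] by (auto simp: T_map_def S_map_def)
    qed
  qed
  show ?thesis
  proof (intro conjI)
    show "x \<in> RP_sol I f xbar \<longleftrightarrow>
        (\<forall>(J, u)\<in>RD_sol I f xbar. J \<in> S_map I f x \<and> (\<forall>j\<in>J. u j \<in> subdiff (f j) x))"
      using sol_iff ex by blast
    show "x \<in> RP_sol I f xbar \<longleftrightarrow>
        (\<exists>(J, u)\<in>RD_sol I f xbar. J \<in> S_map I f x \<and> (\<forall>j\<in>J. u j \<in> subdiff (f j) x))"
      using sol_iff ex by blast
    show "x \<in> RP_sol I f xbar \<longleftrightarrow>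
        (\<exists>(J, u)\<in>dual_feasible I xbar. J \<in> S_map I f x \<and> (\<forall>j\<in>J. u j \<in> subdiff (f j) x))"
      using sol_iff[OF ex] feas[OF ex] iv_i by blast
    show "\<forall>(J, u)\<in>RD_sol I f xbar.
        RP_sol I f xbar = T_map I f J \<inter> (\<Inter>j\<in>J. argmin_map (f j) (u j))"
      using sol_eq by blast
  qed
qed

end
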